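(* For every $\mathcal{L}_2$-formula $A$, the following are equivalent: (1) $\mathbf{GR}^\circ\vdash A$; (2) $A$ is valid on all $\mathbf{GR}^\circ$-frames; (3) $A$ is valid on all finite $\mathbf{GR}^\circ$-frames.
   Context: $\mathcal{L}_2$ is the bimodal propositional language with countably many propositional variables, $\bot$, connectives $\neg,\vee$ (others defined), and unary modal operators $\Box,\blacksquare$; $\Diamond$ abbreviates $\neg\Box\neg$; $\mathrm{MF}_2$ is the set of all $\mathcal{L}_2$-formulas. The logic $\mathbf{GR}^-$ has as axioms all propositional tautologies of $\mathcal{L}_2$ and all instances of $\Box(A\to B)\to(\Box A\to\Box B)$, $\Box(\Box A\to A)\to\Box A$, $\blacksquare A\to\Box A$, $\Box A\to\Box\blacksquare A$, $\Box A\to(\Box\bot\vee\blacksquare A)$, $\Diamond\blacksquare A\to\Diamond A$, and rules modus ponens and $\Box$-necessitation. $\mathbf{GR}^\circ$ is $\mathbf{GR}^-$ plus the rule: from $A$ infer $\blacksquare A$. A $\mathbf{GR}^\circ$-frame is a triple $(W,\sqsubset,\{\prec_B\}_{B\in\mathrm{MF}_2})$ where $W\neq\emptyset$, $\sqsubset$ is a transitive and conversely well-founded binary relation on $W$, and each $\prec_B$ is a binary relation on $W$ such that for all $x,y,z\in W$: (i) $x\sqsubset y\Rightarrow x\prec_B y$; (ii) $x\sqsubset y$ and $y\prec_B z$ imply $x\sqsubset z$; (iii) $x\prec_B y$ and $x\sqsubset z$ imply $x\sqsubset y$; (iv) if $x\sqsubset y$ then there is $z$ with $y\prec_B z$ and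 $x\sqsubset z$. A model on such a frame is given by a satisfaction relation $\Vdash$ obeying the usual clauses for variables and connectives, with $w\Vdash\Box B$ iff $x\Vdash B$ for all $x$ with $w\sqsubset x$, and $w\Vdash\blacksquare B$ iff $x\Vdash B$ for all $x$ with $w\prec_B x$. A formula is valid on a frame if true at every world of every model on it; a frame is finite if $W$ is finite. *)

theory Defs
  imports Main
begin

datatype fm =
    Var nat
  | Falsum ("\<^bold>\<bottom>")
  | Neg fm ("\<^bold>\<not> _" [90] 90)
  | Or fm fm (infixr "\<^bold>\<or>" 75)
  | Box fm ("\<box> _" [90] 90)
  | BBox fm ("\<^bold>\<box> _" [90] 90)

abbreviation Imp :: "fm \<Rightarrow> fm \<Rightarrow> fm" (infixr "\<^bold>\<rightarrow>" 70) where
  "A \<^bold>\<rightarrow> B \<equiv> \<^bold>\<not> A \<^bold>\<or> B"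

abbreviation Dia :: "fm \<Rightarrow> fm" ("\<diamond> _" [90] 90) where
  "\<diamond> A \<equiv> \<^bold>\<not> \<box> \<^bold>\<not> A"

text \<open>Formulas of the form \<open>\<box> A\<close> and \<open>\<^bold>\<box> A\<close> count as propositional atoms here.\<close>

primrec peval :: "(fm \<Rightarrow> bool) \<Rightarrow> fm \<Rightarrow> bool" where
  "peval v (Var n) = v (Var n)"
| "peval v \<^bold>\<bottom> = False"
| "peval v (\<^bold>\<not> A) = (\<not> peval v A)"
| "peval v (A \<^bold>\<or> B) = (peval v A \<or> peval v B)"
| "peval v (\<box> A) = v (\<box> A)"
| "peval v (\<^bold>\<box> A) = v (\<^bold>\<box> A)"

definition tautology :: "fm \<Rightarrow> bool" where
  "tautology A \<longleftrightarrow> (\<forall>v. peval v A)"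

inductive GR_axiom :: "fm \<Rightarrow> bool" where
  Taut: "tautology A \<Longrightarrow> GR_axiom A"
| K: "GR_axiom (\<box> (A \<^bold>\<rightarrow> B) \<^bold>\<rightarrow> (\<box> A \<^bold>\<rightarrow> \<box> B))"
| Loeb: "GR_axiom (\<box> (\<box> A \<^bold>\<rightarrow> A) \<^bold>\<rightarrow> \<box> A)"
| BBox_Box: "GR_axiom (\<^bold>\<box> A \<^bold>\<rightarrow> \<box> A)"
| Box_BBox: "GR_axiom (\<box> A \<^bold>\<rightarrow> \<box> \<^bold>\<box> A)"
| Box_cases: "GR_axiom (\<box> A \<^bold>\<rightarrow> (\<box> \<^bold>\<bottom> \<^bold>\<or> \<^bold>\<box> A))"
| Dia_BBox: "GR_axiom (\<diamond> \<^bold>\<box> A \<^bold>\<rightarrow> \<diamond> A)"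

inductive GRo :: "fm \<Rightarrow> bool" ("\<turnstile>\<^sub>G\<^sub>R\<^sub>o _" [50] 50) where
  Ax: "GR_axiom A \<Longrightarrow> \<turnstile>\<^sub>G\<^sub>R\<^sub>o A"
| MP: "\<turnstile>\<^sub>G\<^sub>R\<^sub>o A \<^bold>\<rightarrow> B \<Longrightarrow> \<turnstile>\<^sub>G\<^sub>R\<^sub>o A \<Longrightarrow> \<turnstile>\<^sub>G\<^sub>R\<^sub>o B"
| Nec_Box: "\<turnstile>\<^sub>G\<^sub>R\<^sub>o A \<Longrightarrow> \<turnstile>\<^sub>G\<^sub>R\<^sub>o \<box> A"
| Nec_BBox: "\<turnstile>\<^sub>G\<^sub>R\<^sub>o A \<Longrightarrow> \<turnstile>\<^sub>G\<^sub>R\<^sub>o \<^bold>\<box> A"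

definition GRo_frame :: "'w set \<Rightarrow> 'w rel \<Rightarrow> (fm \<Rightarrow> 'w rel) \<Rightarrow> bool" where
  "GRo_frame W R P \<longleftrightarrow>
     W \<noteq> {} \<and> R \<subseteq> W \<times> W \<and> trans R \<and> wf (R\<inverse>) \<and>
     (\<forall>B. P B \<subseteq> W \<times> W \<and>
       (\<forall>x\<in>W. \<forall>y\<in>W. (x, y) \<in> R \<longrightarrow> (x, y) \<in> P B) \<and>
       (\<forall>x\<in>W. \<forall>y\<in>W. \<forall>z\<in>W. (x, y) \<in> R \<and> (y, z) \<in> P B \<longrightarrow> (x, z) \<in> R) \<and>
       (\<forall>x\<in>W. \<forall>y\<in>W. \<forall>z\<in>W. (x, y) \<in> P B \<and> (x, z) \<in> R \<longrightarrow> (x, y) \<in> R) \<and>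
       (\<forall>x\<in>W. \<forall>y\<in>W. (x, y) \<in> R \<longrightarrow> (\<exists>z\<in>W. (y, z) \<in> P B \<and> (x, z) \<in> R)))"

text \<open>
  Truth of variables is arbitrary, so there is no clause for \<open>Var\<close>; the values of
  \<open>sat\<close> outside \<open>W\<close> are irrelevant.
\<close>

definition GRo_model ::
  "'w set \<Rightarrow> 'w rel \<Rightarrow> (fm \<Rightarrow> 'w rel) \<Rightarrow> ('w \<Rightarrow> fm \<Rightarrow> bool) \<Rightarrow> bool" where
  "GRo_model W R P sat \<longleftrightarrow>
     (\<forall>w\<in>W.
       \<not> sat w \<^bold>\<bottom> \<and>
       (\<forall>B. sat w (\<^bold>\<not> B) \<longleftrightarrow> \<not> sat w B) \<and>
       (\<forall>B C. sat w (B \<^bold>\<or> C) \<longleftrightarrow> sat w B \<or> sat w C) \<and>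
       (\<forall>B. sat w (\<box> B) \<longleftrightarrow> (\<forall>x\<in>W. (w, x) \<in> R \<longrightarrow> sat x B)) \<and>
       (\<forall>B. sat w (\<^bold>\<box> B) \<longleftrightarrow> (\<forall>x\<in>W. (w, x) \<in> P B \<longrightarrow> sat x B)))"

definition valid_on :: "'w set \<Rightarrow> 'w rel \<Rightarrow> (fm \<Rightarrow> 'w rel) \<Rightarrow> fm \<Rightarrow> bool" where
  "valid_on W R P A \<longleftrightarrow> (\<forall>sat. GRo_model W R P sat \<longrightarrow> (\<forall>w\<in>W. sat w A))"

text \<open>
  HOL cannot quantify over types inside a formula, so the worlds of the frames are
  drawn from a type \<open>'w\<close>. The equivalence is stated for every infinite \<open>'w\<close>: every
  finite frame has an isomorphic copy in each such type, and every frame whatsoever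
  has one in some such type.
\<close>

definition valid_on_all_frames :: "'w itself \<Rightarrow> fm \<Rightarrow> bool" where
  "valid_on_all_frames (_ :: 'w itself) A \<longleftrightarrow>
     (\<forall>(W :: 'w set) R P. GRo_frame W R P \<longrightarrow> valid_on W R P A)"

definition valid_on_all_finite_frames :: "'w itself \<Rightarrow> fm \<Rightarrow> bool" where
  "valid_on_all_finite_frames (_ :: 'w itself) A \<longleftrightarrow>
     (\<forall>(W :: 'w set) R P. GRo_frame W R P \<and> finite W \<longrightarrow> valid_on W R P A)"

end

theory Submission
  imports Defs "HOL-Library.Sublist"
begin

text \<open>
  In a world with a \<open>\<box>\<close>-successor, \<open>\<^bold>\<box> B\<close> is equivalent to \<open>\<box> B\<close>, so the relations for
  \<open>\<^bold>\<box>\<close> have to be designed at endpoints only. The countermodel is a finite forest: its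
  worlds are the chains of (traces on a finite set \<open>\<Phi>\<close> of) maximal consistent sets under
  the usual step relation of the logic GL, and \<open>\<sqsubset>\<close> is proper extension of chains. All proper
  predecessors of an endpoint are initial segments of its immediate predecessor \<open>p\<close>, hence an
  endpoint may safely see, through \<open>\<prec>\<^sub>B\<close>, whatever \<open>p\<close> sees. The axioms
  \<open>\<box> B \<^bold>\<rightarrow> \<box> \<^bold>\<box> B\<close> and \<open>\<diamond> \<^bold>\<box> B \<^bold>\<rightarrow> \<diamond> B\<close> at \<open>p\<close> supply the needed witnesses
  refuting, respectively satisfying, \<open>B\<close>. An endpoint that is a root may see
  every world, and if it refutes \<open>\<^bold>\<box> B\<close>, then \<open>B\<close> is unprovable by the rule for \<open>\<^bold>\<box>\<close>
  and so fails at some root.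
\<close>

section \<open>Soundness\<close>

lemma GRo_model_sat:
  assumes "GRo_model W R P sat" and "w \<in> W"
  shows "\<not> sat w \<^bold>\<bottom>"
    and "sat w (\<^bold>\<not> B) \<longleftrightarrow> \<not> sat w B"
    and "sat w (B \<^bold>\<or> C) \<longleftrightarrow> sat w B \<or> sat w C"
    and "sat w (\<box> B) \<longleftrightarrow> (\<forall>x\<in>W. (w, x) \<in> R \<longrightarrow> sat x B)"
    and "sat w (\<^bold>\<box> B) \<longleftrightarrow> (\<forall>x\<in>W. (w, x) \<in> P B \<longrightarrow> sat x B)"
  using assms unfolding GRo_model_def by blast+

text \<open>Boxed formulas are atoms for \<open>peval\<close>, so \<open>sat w\<close> itself is a
  propositional valuation. Hence tautologies hold at every world.\<close>

lemma peval_sat: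
  assumes "GRo_model W R P sat" and "w \<in> W"
  shows "peval (sat w) A = sat w A"
  using assms by (induction A) (simp_all add: GRo_model_sat)

text \<open>Each frame condition accounts for one axiom: \<open>R_P\<close> for
  \<open>BBox_Box\<close>, \<open>R_P_R\<close> for \<open>Box_BBox\<close>, \<open>P_R\<close> for
  \<open>Box_cases\<close> and \<open>serial\<close> for \<open>Dia_BBox\<close>.\<close>

lemma GR_axiom_sound:
  assumes frame: "GRo_frame W R P" and model: "GRo_model W R P sat"
    and "GR_axiom A" and "w \<in> W"
  shows "sat w A"
proof -
  note [simp] = GRo_model_sat[OF model]
  have R_P: "(x, y) \<in> P B" if "(x, y) \<in> R" for x y B
    using frame that unfolding GRo_frame_def by blast
  have R_P_R: "(x, z) \<in> R" if "(x, y) \<in> R" "(y, z) \<in> P B" for x y z B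
    using frame that unfolding GRo_frame_def by blast
  have P_R: "(x, y) \<in> R" if "(x, y) \<in> P B" "(x, z) \<in> R" for x y z B
    using frame that unfolding GRo_frame_def by blast
  have serial: "\<exists>z\<in>W. (y, z) \<in> P B \<and> (x, z) \<in> R" if "(x, y) \<in> R" for x y B
    using frame that unfolding GRo_frame_def by blast
  from \<open>GR_axiom A\<close> show ?thesis
  proof cases
    case Taut
    then show ?thesis
      using peval_sat[OF model \<open>w \<in> W\<close>] by (auto simp: tautology_def)
  next
    case (Loeb B)
    have "wf (R\<inverse>)" and tr: "trans R" using frame by (auto simp: GRo_frame_def)
    \<comment> \<open>Induction from the \<open>R\<close>-maximal worlds downwards. By transitivity
      all successors of \<open>x\<close> are successors of \<open>w\<close>, so the induction
      hypothesis gives \<open>Box B\<close> at \<open>x\<close>, and \<open>prem\<close> turns this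
      into \<open>B\<close>.\<close>
    have "sat x B" if prem: "\<forall>y\<in>W. (w, y) \<in> R \<longrightarrow> sat y (\<box> B \<^bold>\<rightarrow> B)"
      and "x \<in> W" "(w, x) \<in> R" for x
      using \<open>wf (R\<inverse>)\<close> that(2,3)
    proof (induction x rule: wf_induct_rule)
      case (less x)
      have "sat y B" if "y \<in> W" "(x, y) \<in> R" for y
        using less that transD[OF tr] by blast
      then show ?case using prem less.prems by auto
    qed
    then show ?thesis unfolding Loeb using \<open>w \<in> W\<close> by auto
  next
    case (K B C)
    then show ?thesis using \<open>w \<in> W\<close> by auto
  next
    case (BBox_Box B)
    then show ?thesis using \<open>w \<in> W\<close> by (auto dest: R_P)
  next
    case (Box_BBox B)
    then show ?thesis using \<open>w \<in> W\<close> by (auto dest: R_P_R)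
  next
    case (Box_cases B)
    then show ?thesis using \<open>w \<in> W\<close> by (auto dest: P_R)
  next
    case (Dia_BBox B)
    then show ?thesis using \<open>w \<in> W\<close> serial[where B = B] by simp blast
  qed
qed

lemma GRo_sound:
  assumes "\<turnstile>\<^sub>G\<^sub>R\<^sub>o A" and "GRo_frame W R P"
  shows "valid_on W R P A"
proof -
  have "\<forall>w\<in>W. sat w A" if model: "GRo_model W R P sat" for sat
    using assms(1)
  proof induction
    case (Ax A)
    then show ?case using GR_axiom_sound[OF assms(2) model] by simp
  qed (simp_all add: GRo_model_sat[OF model])
  then show ?thesis unfolding valid_on_def by iprover
qed

section \<open>Maximal consistent sets\<close>

text \<open>Closure under modus ponens but not under necessitation: the formulas true at a single
  world of a model form such a set.\<close>

definition deductive :: "fm set \<Rightarrow> bool" where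
  "deductive T \<longleftrightarrow> (\<forall>A. (\<turnstile>\<^sub>G\<^sub>R\<^sub>o A) \<longrightarrow> A \<in> T) \<and> (\<forall>A B. A \<^bold>\<rightarrow> B \<in> T \<longrightarrow> A \<in> T \<longrightarrow> B \<in> T)"

definition mcs :: "fm set \<Rightarrow> bool" where
  "mcs M \<longleftrightarrow> deductive M \<and> (\<forall>A. \<^bold>\<not> A \<in> M \<longleftrightarrow> A \<notin> M)"

lemma GRo_taut: "tautology A \<Longrightarrow> \<turnstile>\<^sub>G\<^sub>R\<^sub>o A"
  by (intro GRo.Ax GR_axiom.Taut)

lemma deductive_thm: "deductive T \<Longrightarrow> \<turnstile>\<^sub>G\<^sub>R\<^sub>o A \<Longrightarrow> A \<in> T"
  by (simp add: deductive_def)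

lemma deductive_MP: "deductive T \<Longrightarrow> A \<^bold>\<rightarrow> B \<in> T \<Longrightarrow> A \<in> T \<Longrightarrow> B \<in> T"
  unfolding deductive_def by blast

lemma deductive_imp: "deductive T \<Longrightarrow> \<turnstile>\<^sub>G\<^sub>R\<^sub>o A \<^bold>\<rightarrow> B \<Longrightarrow> A \<in> T \<Longrightarrow> B \<in> T"
  using deductive_thm deductive_MP by blast

lemma deductive_taut:
  "deductive T \<Longrightarrow> tautology (A \<^bold>\<rightarrow> B) \<Longrightarrow> A \<in> T \<Longrightarrow> B \<in> T"
  using deductive_imp GRo_taut by blast

lemma deductive_taut2:
  "deductive T \<Longrightarrow> tautology (A \<^bold>\<rightarrow> B \<^bold>\<rightarrow> C) \<Longrightarrow> A \<in> T \<Longrightarrow> B \<in> T \<Longrightarrow> C \<in> T"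
  using deductive_taut deductive_MP by blast

text \<open>Zorn's lemma is applied to the deductive extensions of \<open>T\<close> that omit
  \<open>F\<close>. A maximal one decides every formula, since a formula outside it must imply
  \<open>F\<close>.\<close>

lemma lindenbaum:
  assumes "deductive T" and "F \<notin> T"
  obtains M where "mcs M" "T \<subseteq> M" "F \<notin> M"
proof -
  define \<T> where "\<T> = {U. deductive U \<and> T \<subseteq> U \<and> F \<notin> U}"
  have "\<Union>\<C> \<in> \<T>" if "\<C> \<noteq> {}" and chain: "subset.chain \<T> \<C>" for \<C>
  proof -
    have sub: "\<C> \<subseteq> \<T>" and lin: "\<And>U V. U \<in> \<C> \<Longrightarrow> V \<in> \<C> \<Longrightarrow> U \<subseteq> V \<or> V \<subseteq> U"
      using chain by (auto simp: subset_chain_def)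
    obtain U where "U \<in> \<C>" using \<open>\<C> \<noteq> {}\<close> by blast
    moreover have "B \<in> \<Union>\<C>" if imp: "A \<^bold>\<rightarrow> B \<in> \<Union>\<C>" and A: "A \<in> \<Union>\<C>" for A B
    proof -
      from imp A obtain V V' where "V \<in> \<C>" "A \<^bold>\<rightarrow> B \<in> V" "V' \<in> \<C>" "A \<in> V'" by blast
      with lin obtain V'' where "V'' \<in> \<C>" "A \<^bold>\<rightarrow> B \<in> V''" "A \<in> V''" by blast
      then show ?thesis using sub deductive_MP unfolding \<T>_def by blast
    qed
    ultimately show ?thesis
      using sub deductive_thm unfolding \<T>_def deductive_def by blast
  qed
  moreover have "T \<in> \<T>" using assms by (simp add: \<T>_def)
  ultimately obtain M where M: "M \<in> \<T>" and max: "\<And>U. U \<in> \<T> \<Longrightarrow> M \<subseteq> U \<Longrightarrow> U = M"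
    using subset_Zorn_nonempty[of \<T>] by blast
  have ded: "deductive M" and "T \<subseteq> M" and F: "F \<notin> M" using M by (auto simp: \<T>_def)
  have imp_F: "B \<^bold>\<rightarrow> F \<in> M" if "B \<notin> M" for B
  proof (rule ccontr)
    assume notin: "B \<^bold>\<rightarrow> F \<notin> M"
    \<comment> \<open>This is the least deductive set containing \<open>M\<close> and
      \<open>B\<close>. It omits \<open>F\<close> exactly because \<open>B\<close> does not imply
      \<open>F\<close> in \<open>M\<close>, so maximality would put \<open>B\<close> into
      \<open>M\<close>.\<close>
    define U where "U = {C. B \<^bold>\<rightarrow> C \<in> M}"
    have "M \<subseteq> U"
    proof
      fix C assume "C \<in> M"
      moreover have "tautology (C \<^bold>\<rightarrow> B \<^bold>\<rightarrow> C)" by (auto simp: tautology_def)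
      ultimately show "C \<in> U" using deductive_taut[OF ded] unfolding U_def by blast
    qed
    moreover have "deductive U"
      unfolding deductive_def
    proof (intro conjI allI impI)
      fix A assume "\<turnstile>\<^sub>G\<^sub>R\<^sub>o A"
      then show "A \<in> U" using \<open>M \<subseteq> U\<close> deductive_thm[OF ded] by blast
    next
      fix A C assume "A \<^bold>\<rightarrow> C \<in> U" "A \<in> U"
      moreover have "tautology ((B \<^bold>\<rightarrow> A \<^bold>\<rightarrow> C) \<^bold>\<rightarrow> (B \<^bold>\<rightarrow> A) \<^bold>\<rightarrow> (B \<^bold>\<rightarrow> C))"
        by (auto simp: tautology_def)
      ultimately show "C \<in> U" using deductive_taut2[OF ded] unfolding U_def by blast
    qed
    ultimately have "U \<in> \<T>" using \<open>T \<subseteq> M\<close> notin by (auto simp: \<T>_def U_def)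
    then have "U = M" using max \<open>M \<subseteq> U\<close> by blast
    moreover have "B \<in> U"
      using deductive_thm[OF ded] GRo_taut by (auto simp: U_def tautology_def)
    ultimately show False using that by blast
  qed
  have "\<^bold>\<not> B \<in> M \<longleftrightarrow> B \<notin> M" for B
  proof
    assume "\<^bold>\<not> B \<in> M"
    then show "B \<notin> M"
      using deductive_taut2[OF ded, of "\<^bold>\<not> B" B F] F by (auto simp: tautology_def)
  next
    assume "B \<notin> M"
    show "\<^bold>\<not> B \<in> M"
    proof (rule ccontr)
      assume "\<^bold>\<not> B \<notin> M"
      \<comment> \<open>If both \<open>B\<close> and its negation were missing, both would imply
        \<open>F\<close>, and a case distinction would put \<open>F\<close> into
        \<open>M\<close>.\<close>
      then have "\<^bold>\<not> B \<^bold>\<rightarrow> F \<in> M" "B \<^bold>\<rightarrow> F \<in> M" using imp_F \<open>B \<notin> M\<close> by blast+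
      then show False
        using deductive_taut2[OF ded, of "\<^bold>\<not> B \<^bold>\<rightarrow> F" "B \<^bold>\<rightarrow> F" F] F
        by (auto simp: tautology_def)
    qed
  qed
  then show thesis using that ded \<open>T \<subseteq> M\<close> F by (auto simp: mcs_def)
qed

lemma unprovable_mcs:
  assumes "\<not> (\<turnstile>\<^sub>G\<^sub>R\<^sub>o A)"
  obtains M where "mcs M" "A \<notin> M"
proof -
  have "deductive {B. \<turnstile>\<^sub>G\<^sub>R\<^sub>o B}" by (auto simp: deductive_def intro: GRo.MP)
  from lindenbaum[OF this] show thesis using assms that by blast
qed

context
  fixes M assumes M: "mcs M"
begin

lemma mcs_deductive: "deductive M"
  using M by (simp add: mcs_def)

lemma mcs_Neg: "\<^bold>\<not> A \<in> M \<longleftrightarrow> A \<notin> M"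
  using M by (simp add: mcs_def)

lemma mcs_Falsum: "\<^bold>\<bottom> \<notin> M"
  using deductive_thm[OF mcs_deductive GRo_taut, of "\<^bold>\<not> \<^bold>\<bottom>"] mcs_Neg
  by (auto simp: tautology_def)

lemma mcs_Or: "A \<^bold>\<or> B \<in> M \<longleftrightarrow> A \<in> M \<or> B \<in> M"
proof
  assume "A \<^bold>\<or> B \<in> M"
  moreover have "tautology ((A \<^bold>\<or> B) \<^bold>\<rightarrow> \<^bold>\<not> A \<^bold>\<rightarrow> B)" by (auto simp: tautology_def)
  ultimately show "A \<in> M \<or> B \<in> M"
    using deductive_taut2[OF mcs_deductive] mcs_Neg by blast
next
  have "tautology (A \<^bold>\<rightarrow> A \<^bold>\<or> B)" "tautology (B \<^bold>\<rightarrow> A \<^bold>\<or> B)" by (auto simp: tautology_def)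
  then show "A \<in> M \<or> B \<in> M \<Longrightarrow> A \<^bold>\<or> B \<in> M"
    using deductive_taut[OF mcs_deductive] by blast
qed

lemma mcs_axiom: "GR_axiom (A \<^bold>\<rightarrow> B) \<Longrightarrow> A \<in> M \<Longrightarrow> B \<in> M"
  using deductive_imp[OF mcs_deductive] GRo.Ax by blast

lemma mcs_K: "\<box> (A \<^bold>\<rightarrow> B) \<in> M \<Longrightarrow> \<box> A \<in> M \<Longrightarrow> \<box> B \<in> M"
  using mcs_axiom[OF GR_axiom.K] deductive_MP[OF mcs_deductive] by blast

lemma mcs_Box_mono: "\<turnstile>\<^sub>G\<^sub>R\<^sub>o A \<^bold>\<rightarrow> B \<Longrightarrow> \<box> A \<in> M \<Longrightarrow> \<box> B \<in> M"
  using mcs_K deductive_thm[OF mcs_deductive] GRo.Nec_Box by blast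

text \<open>Transitivity is obtained from \<open>Box_BBox\<close> by weakening the inner
  \<open>BBox\<close> to \<open>Box\<close> under the outer box.\<close>

lemma mcs_Box_Box: "\<box> A \<in> M \<Longrightarrow> \<box> \<box> A \<in> M"
  using mcs_axiom[OF GR_axiom.Box_BBox] mcs_Box_mono[OF GRo.Ax[OF GR_axiom.BBox_Box]] by blast

text \<open>
  The theory of all \<open>E\<close> with \<open>\<box> (\<box> C \<^bold>\<rightarrow> E) \<in> M\<close> omits \<open>C\<close> by Loeb's axiom.
\<close>

lemma mcs_Box_witness:
  assumes "\<box> C \<notin> M"
  obtains M' where "mcs M'" "C \<notin> M'" "\<box> C \<in> M'"
    "\<And>D. \<box> D \<in> M \<Longrightarrow> D \<in> M' \<and> \<box> D \<in> M'"
proof -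
  define T where "T = {E. \<box> (\<box> C \<^bold>\<rightarrow> E) \<in> M}"
  have Box_T: "D \<in> T" if "\<box> D \<in> M" for D
    unfolding T_def mem_Collect_eq
    by (rule mcs_Box_mono[OF GRo_taut that]) (auto simp: tautology_def)
  have "deductive T"
    unfolding deductive_def
  proof (intro conjI allI impI)
    fix A assume "\<turnstile>\<^sub>G\<^sub>R\<^sub>o A"
    then show "A \<in> T" using Box_T deductive_thm[OF mcs_deductive] GRo.Nec_Box by blast
  next
    fix A B assume "A \<^bold>\<rightarrow> B \<in> T" "A \<in> T"
    moreover have "tautology ((\<box> C \<^bold>\<rightarrow> A \<^bold>\<rightarrow> B) \<^bold>\<rightarrow> (\<box> C \<^bold>\<rightarrow> A) \<^bold>\<rightarrow> (\<box> C \<^bold>\<rightarrow> B))"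
      by (auto simp: tautology_def)
    ultimately show "B \<in> T"
      unfolding T_def using mcs_Box_mono[OF GRo_taut] mcs_K by blast
  qed
  moreover have "C \<notin> T"
    unfolding T_def using mcs_axiom[OF GR_axiom.Loeb] assms by blast
  ultimately obtain M' where M': "mcs M'" "T \<subseteq> M'" "C \<notin> M'" by (rule lindenbaum)
  have "\<turnstile>\<^sub>G\<^sub>R\<^sub>o \<box> C \<^bold>\<rightarrow> \<box> C" by (rule GRo_taut) (auto simp: tautology_def)
  then have "\<box> C \<in> T"
    unfolding T_def using deductive_thm[OF mcs_deductive] GRo.Nec_Box by blast
  then show thesis using that M' Box_T mcs_Box_Box by blast
qed

end

section \<open>The finite countermodel\<close>

primrec subfms :: "fm \<Rightarrow> fm set" where
  "subfms (Var n) = {Var n}"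
| "subfms \<^bold>\<bottom> = {\<^bold>\<bottom>}"
| "subfms (\<^bold>\<not> A) = insert (\<^bold>\<not> A) (subfms A)"
| "subfms (A \<^bold>\<or> B) = insert (A \<^bold>\<or> B) (subfms A \<union> subfms B)"
| "subfms (\<box> A) = insert (\<box> A) (subfms A)"
| "subfms (\<^bold>\<box> A) = insert (\<^bold>\<box> A) (subfms A)"

lemma subfms_self: "A \<in> subfms A"
  by (cases A) auto

lemma finite_subfms: "finite (subfms A)"
  by (induction A) auto

lemma subfms_trans: "B \<in> subfms A \<Longrightarrow> subfms B \<subseteq> subfms A"
  by (induction A) auto

text \<open>Whereas \<open>GRo_model\<close> only constrains a given satisfaction relation, this
  recursion constructs one from a valuation of the variables.\<close>

primrec eval :: "'w set \<Rightarrow> 'w rel \<Rightarrow> (fm \<Rightarrow> 'w rel) \<Rightarrow> ('w \<Rightarrow> nat \<Rightarrow> bool) \<Rightarrow> fm \<Rightarrow> 'w \<Rightarrow> bool" where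
  "eval W R P V (Var n) w = V w n"
| "eval W R P V \<^bold>\<bottom> w = False"
| "eval W R P V (\<^bold>\<not> A) w = (\<not> eval W R P V A w)"
| "eval W R P V (A \<^bold>\<or> B) w = (eval W R P V A w \<or> eval W R P V B w)"
| "eval W R P V (\<box> A) w = (\<forall>x\<in>W. (w, x) \<in> R \<longrightarrow> eval W R P V A x)"
| "eval W R P V (\<^bold>\<box> A) w = (\<forall>x\<in>W. (w, x) \<in> P A \<longrightarrow> eval W R P V A x)"

lemma GRo_model_eval: "GRo_model W R P (\<lambda>w A. eval W R P V A w)"
  by (simp add: GRo_model_def)

section \<open>Traces of maximal consistent sets and the worlds built from them\<close>

text \<open>The second conjunct makes the relation strict: each step gains a boxed formula. This
  bounds the length of chains of traces.\<close>

definition step :: "fm set \<Rightarrow> fm set \<Rightarrow> bool" where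
  "step c a \<longleftrightarrow> (\<forall>D. \<box> D \<in> c \<longrightarrow> D \<in> a \<and> \<box> D \<in> a) \<and> (\<exists>D. \<box> D \<in> a \<and> \<box> D \<notin> c)"

lemma step_irrefl: "\<not> step a a"
  by (auto simp: step_def)

lemma step_trans: "step a b \<Longrightarrow> step b c \<Longrightarrow> step a c"
  unfolding step_def by blast

text \<open>\<open>S\<close> stands for the subformulas of the refuted formula together with
  \<open>Falsum\<close>. The latter puts \<open>Box Falsum\<close> into \<Phi>, so that a trace
  records whether its world is an endpoint.\<close>

locale countermodel =
  fixes S :: "fm set"
  assumes finite_S: "finite S"
    and Falsum_S: "\<^bold>\<bottom> \<in> S"
    and subfms_S: "B \<in> S \<Longrightarrow> subfms B \<subseteq> S"
begin

text \<open>For \<open>BBox B\<close> in \<open>S\<close>, the axioms \<open>Box_BBox\<close> and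
  \<open>Dia_BBox\<close> are used at the immediate predecessor of an endpoint. They involve the
  boxes of \<open>B\<close>, \<open>BBox B\<close> and their negations, all of which lie in this
  set.\<close>

definition \<Phi> :: "fm set" where
  "\<Phi> = S \<union> Neg ` S \<union> Box ` (S \<union> Neg ` S)"

definition traces :: "fm set set" where
  "traces = {M \<inter> \<Phi> | M. mcs M}"

text \<open>A world carries its whole history, so that its predecessors are linearly ordered and are
  shared by its siblings.\<close>

definition worlds :: "fm set list set" where
  "worlds = {w. w \<noteq> [] \<and> set w \<subseteq> traces \<and> sorted_wrt step w}"

definition acc :: "fm set list rel" where
  "acc = {(x, y). x \<in> worlds \<and> y \<in> worlds \<and> strict_prefix x y}"

text \<open>Where there is an \<open>acc\<close>-successor, the frame conditions force equality with
  \<open>acc\<close>. At an endpoint \<open>w\<close> this is the largest relation compatible with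
  two demands: predecessors of \<open>w\<close> must see \<open>z\<close>, and \<open>BBox B\<close>
  in the trace of \<open>w\<close> must be true there.\<close>

definition bacc :: "fm \<Rightarrow> fm set list rel" where
  "bacc B = acc \<union> {(w, z). w \<in> worlds \<and> z \<in> worlds \<and> acc `` {w} = {} \<and>
     (\<forall>p. (p, w) \<in> acc \<longrightarrow> (p, z) \<in> acc) \<and> (\<^bold>\<box> B \<in> last w \<longrightarrow> B \<in> last z)}"

lemma S_components:
  "\<^bold>\<not> A \<in> S \<Longrightarrow> A \<in> S"
  "A \<^bold>\<or> B \<in> S \<Longrightarrow> A \<in> S"
  "A \<^bold>\<or> B \<in> S \<Longrightarrow> B \<in> S"
  "\<box> A \<in> S \<Longrightarrow> A \<in> S"
  "\<^bold>\<box> A \<in> S \<Longrightarrow> A \<in> S"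
  using subfms_S subfms_self by fastforce+

lemma \<Phi>_memberships:
  "A \<in> S \<Longrightarrow> A \<in> \<Phi>"
  "A \<in> S \<Longrightarrow> \<^bold>\<not> A \<in> \<Phi>"
  "A \<in> S \<Longrightarrow> \<box> A \<in> \<Phi>"
  "A \<in> S \<Longrightarrow> \<box> \<^bold>\<not> A \<in> \<Phi>"
  by (auto simp: \<Phi>_def)

lemma Box_\<Phi>: "\<box> A \<in> \<Phi> \<Longrightarrow> A \<in> \<Phi>"
  by (auto simp: \<Phi>_def dest: S_components)

lemma BBox_\<Phi>: "\<^bold>\<box> A \<in> \<Phi> \<Longrightarrow> \<^bold>\<box> A \<in> S"
  by (auto simp: \<Phi>_def)

lemma trace_mcs:
  assumes "a \<in> traces"
  obtains M where "mcs M" "a = M \<inter> \<Phi>"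
  using assms by (auto simp: traces_def)

text \<open>The maximal consistent set supplied by Loeb's axiom contains \<open>Box C\<close>, which
  \<open>c\<close> lacks; this is the gain that \<open>step\<close> requires.\<close>

lemma Box_witness:
  assumes "c \<in> traces" and "\<box> C \<in> \<Phi>" and "\<box> C \<notin> c"
  obtains a where "a \<in> traces" "step c a" "C \<notin> a"
proof -
  obtain M where M: "mcs M" "c = M \<inter> \<Phi>" using assms(1) by (rule trace_mcs)
  then have "\<box> C \<notin> M" using assms by blast
  with M(1) obtain M' where "mcs M'" "C \<notin> M'" "\<box> C \<in> M'"
    "\<And>D. \<box> D \<in> M \<Longrightarrow> D \<in> M' \<and> \<box> D \<in> M'"
    by (rule mcs_Box_witness) blast
  then have "M' \<inter> \<Phi> \<in> traces" "step c (M' \<inter> \<Phi>)" "C \<notin> M' \<inter> \<Phi>"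
    using M assms Box_\<Phi> by (auto simp: traces_def step_def)
  then show thesis by (rule that)
qed

text \<open>\<open>sorted_wrt\<close> relates all pairs of entries, so irreflexivity of
  \<open>step\<close> makes every chain repetition-free, and there are only finitely many such lists
  over the finite set of traces.\<close>

lemma finite_worlds: "finite worlds"
proof -
  have "traces \<subseteq> Pow \<Phi>" by (auto simp: traces_def)
  moreover have "finite \<Phi>" using finite_S by (simp add: \<Phi>_def)
  ultimately have "finite traces" using finite_subset by blast
  moreover have "distinct w" if "sorted_wrt step w" for w
    using that by (induction w) (auto simp: step_irrefl)
  ultimately show ?thesis
    using finite_subset_distinct[of traces] by (auto simp: worlds_def elim!: rev_finite_subset)
qed

lemma last_traces: "w \<in> worlds \<Longrightarrow> last w \<in> traces"
  by (auto simp: worlds_def)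

lemma Falsum_notin_last: "w \<in> worlds \<Longrightarrow> \<^bold>\<bottom> \<notin> last w"
  using last_traces mcs_Falsum by (blast elim: trace_mcs)

lemma worlds_singleton: "[a] \<in> worlds \<longleftrightarrow> a \<in> traces"
  by (auto simp: worlds_def)

lemma worlds_snoc:
  assumes "p \<noteq> []"
  shows "p @ [a] \<in> worlds \<longleftrightarrow> p \<in> worlds \<and> a \<in> traces \<and> step (last p) a"
proof -
  have "step b a" if "sorted_wrt step p" "b \<in> set p" "step (last p) a" for b
    using that
    by (cases p rule: rev_cases) (auto simp: sorted_wrt_append intro: step_trans)
  then show ?thesis using assms by (auto simp: worlds_def sorted_wrt_append)
qed

lemma acc_step:
  assumes "(x, y) \<in> acc"
  shows "step (last x) (last y)"
proof -
  obtain zs where "y = x @ zs" "zs \<noteq> []"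
    using assms by (auto simp: acc_def strict_prefix_def prefix_def)
  then show ?thesis using assms by (auto simp: acc_def worlds_def sorted_wrt_append)
qed

lemma acc_snoc: "p \<noteq> [] \<Longrightarrow> p @ [a] \<in> worlds \<Longrightarrow> (p, p @ [a]) \<in> acc"
  by (auto simp: acc_def worlds_snoc strict_prefix_def)

text \<open>A proper prefix of \<open>p @ [a]\<close> is a prefix of \<open>p\<close>. This verifies
  the condition on predecessors in \<open>bacc\<close> whenever an endpoint is to see one of its
  siblings.\<close>

lemma acc_siblings:
  assumes "(q, p @ [a]) \<in> acc" and "p @ [b] \<in> worlds"
  shows "(q, p @ [b]) \<in> acc"
proof -
  have "prefix q p" using assms(1) by (auto simp: acc_def strict_prefix_def)
  then have "strict_prefix q (p @ [b])" by (auto simp: strict_prefix_def prefix_def)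
  then show ?thesis using assms by (simp add: acc_def)
qed

lemma acc_witness:
  assumes "w \<in> worlds" and "\<box> C \<in> \<Phi>" and "\<box> C \<notin> last w"
  obtains a where "(w, w @ [a]) \<in> acc" "C \<notin> a"
proof -
  have "w \<noteq> []" using assms(1) by (simp add: worlds_def)
  obtain a where "a \<in> traces" "step (last w) a" "C \<notin> a"
    using Box_witness last_traces assms by blast
  then show thesis using that acc_snoc worlds_snoc assms(1) \<open>w \<noteq> []\<close> by blast
qed

section \<open>The frame conditions\<close>

lemma trans_acc: "trans acc"
  by (auto simp: acc_def trans_def)

lemma bacc_serial:
  assumes "(x, y) \<in> acc"
  shows "\<exists>z\<in>worlds. (y, z) \<in> bacc B \<and> (x, z) \<in> acc"
proof (cases "acc `` {y} = {}")
  case False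
  then obtain z where "(y, z) \<in> acc" by blast
  then show ?thesis
    using transD[OF trans_acc assms] by (auto simp: bacc_def acc_def)
next
  case endpoint: True
  have y: "x \<in> worlds" "y \<in> worlds" "x \<noteq> []" "strict_prefix x y"
    using assms by (auto simp: acc_def worlds_def)
  show ?thesis
  proof (cases "\<^bold>\<box> B \<in> last y")
    case False
    \<comment> \<open>Here \<open>y\<close> may see itself: the last condition in
      \<open>bacc\<close> is vacuous.\<close>
    then show ?thesis using endpoint y assms by (auto simp: bacc_def)
  next
    case True
    obtain p a where pa: "y = p @ [a]" using y by (cases y rule: rev_cases) auto
    then have "p \<noteq> []" using y by (auto simp: strict_prefix_def)
    then have p: "p \<in> worlds" "a \<in> traces" "step (last p) a" using worlds_snoc y pa by auto
    obtain N where N: "mcs N" "a = N \<inter> \<Phi>" using p(2) by (rule trace_mcs)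
    obtain M where M: "mcs M" "last p = M \<inter> \<Phi>" using last_traces[OF p(1)] by (rule trace_mcs)
    have "\<^bold>\<box> B \<in> \<Phi>" using True pa N by simp
    then have S: "\<^bold>\<box> B \<in> S" "B \<in> S" using BBox_\<Phi> S_components by blast+
    have "\<^bold>\<not> \<^bold>\<box> B \<notin> a" using True pa N mcs_Neg by auto
    \<comment> \<open>The step from \<open>last p\<close> to \<open>a\<close> would carry the
      negation of \<open>BBox B\<close> into \<open>a\<close> if its box were in \<open>M\<close>.
      So \<open>M\<close> contains the diamond of \<open>BBox B\<close>, and by
      \<open>Dia_BBox\<close> also that of \<open>B\<close>. This yields a sibling of
      \<open>y\<close> whose trace contains \<open>B\<close>.\<close>
    then have "\<box> \<^bold>\<not> \<^bold>\<box> B \<notin> M"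
      using p(3) M S \<Phi>_memberships by (auto simp: step_def)
    then have "\<box> \<^bold>\<not> B \<notin> M"
      using mcs_axiom[OF M(1) GR_axiom.Dia_BBox] mcs_Neg[OF M(1)] by blast
    then obtain b where b: "(p, p @ [b]) \<in> acc" "\<^bold>\<not> B \<notin> b"
      using acc_witness[OF p(1), of "\<^bold>\<not> B"] M S \<Phi>_memberships by blast
    then have z: "p @ [b] \<in> worlds" by (simp add: acc_def)
    then have "b \<in> traces" using worlds_snoc \<open>p \<noteq> []\<close> by blast
    then have "B \<in> b"
      using b(2) S \<Phi>_memberships mcs_Neg by (auto elim!: trace_mcs)
    then have "(y, p @ [b]) \<in> bacc B"
      using endpoint y z acc_siblings pa by (auto simp: bacc_def)
    moreover have "(x, p @ [b]) \<in> acc" using assms z acc_siblings pa by blast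
    ultimately show ?thesis using z by blast
  qed
qed

text \<open>Finiteness and acyclicity give converse well-foundedness. The pairs that
  \<open>bacc\<close> adds to \<open>acc\<close> start at endpoints, where the third frame condition
  is vacuous; the second one is built into \<open>bacc\<close>.\<close>

lemma GRo_frame_worlds:
  assumes "worlds \<noteq> {}"
  shows "GRo_frame worlds acc bacc"
proof -
  have acc_W: "acc \<subseteq> worlds \<times> worlds" by (auto simp: acc_def)
  have "irrefl acc" by (auto simp: acc_def irrefl_def)
  then have "acyclic acc" by (simp add: acyclic_irrefl trancl_id trans_acc)
  moreover have "finite acc" using finite_subset[OF acc_W] finite_worlds by blast
  ultimately have "wf (acc\<inverse>)" by (simp add: finite_acyclic_wf_converse)
  moreover have "bacc B \<subseteq> worlds \<times> worlds" for B using acc_W by (auto simp: bacc_def)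
  moreover have "(x, y) \<in> bacc B" if "(x, y) \<in> acc" for x y B
    using that by (simp add: bacc_def)
  moreover have "(x, z) \<in> acc" if "(x, y) \<in> acc" "(y, z) \<in> bacc B" for x y z B
    using that transD[OF trans_acc] by (auto simp: bacc_def)
  moreover have "(x, y) \<in> acc" if "(x, y) \<in> bacc B" "(x, z) \<in> acc" for x y z B
    using that by (auto simp: bacc_def)
  ultimately show ?thesis
    unfolding GRo_frame_def using assms acc_W trans_acc bacc_serial by blast
qed

section \<open>The truth lemma\<close>

text \<open>As \<open>BBox B\<close> is missing at \<open>w\<close>, only predecessors restrict the
  choice of \<open>z\<close>. A root has none, so any one-element chain will do; otherwise a sibling
  is taken.\<close>

lemma endpoint_BBox_witness:
  assumes w: "w \<in> worlds" and endpoint: "acc `` {w} = {}" and S: "\<^bold>\<box> B \<in> S"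
    and notin: "\<^bold>\<box> B \<notin> last w"
  shows "\<exists>z. (w, z) \<in> bacc B \<and> B \<notin> last z"
proof -
  have BS: "B \<in> S" using S S_components by blast
  obtain p a where pa: "w = p @ [a]" using w by (cases w rule: rev_cases) (auto simp: worlds_def)
  show ?thesis
  proof (cases "p = []")
    case True
    then have a: "a \<in> traces" using w pa worlds_singleton by auto
    then have "\<not> (\<turnstile>\<^sub>G\<^sub>R\<^sub>o \<^bold>\<box> B)"
      using notin pa S \<Phi>_memberships mcs_deductive deductive_thm by (fastforce elim!: trace_mcs)
    then have "\<not> (\<turnstile>\<^sub>G\<^sub>R\<^sub>o B)" using GRo.Nec_BBox by blast
    then obtain M where "mcs M" "B \<notin> M" by (rule unprovable_mcs)
    then have "[M \<inter> \<Phi>] \<in> worlds" "B \<notin> last [M \<inter> \<Phi>]"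
      by (auto simp: worlds_singleton traces_def)
    moreover have "(q, w) \<notin> acc" for q
      using True pa by (auto simp: acc_def worlds_def strict_prefix_def prefix_Cons)
    ultimately show ?thesis using w endpoint notin by (auto simp: bacc_def)
  next
    case False
    then have p: "p \<in> worlds" "step (last p) a" using w pa worlds_snoc by auto
    obtain M where M: "mcs M" "last p = M \<inter> \<Phi>" using last_traces[OF p(1)] by (rule trace_mcs)
    \<comment> \<open>Otherwise the step from \<open>last p\<close> to \<open>a\<close> would put
      \<open>BBox B\<close> into \<open>a\<close>.\<close>
    have "\<box> \<^bold>\<box> B \<notin> M"
      using p(2) M notin pa S \<Phi>_memberships by (auto simp: step_def)
    then have "\<box> B \<notin> M" using mcs_axiom[OF M(1) GR_axiom.Box_BBox] by blast
    then obtain b where b: "(p, p @ [b]) \<in> acc" "B \<notin> b"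
      using acc_witness[OF p(1), of B] M BS \<Phi>_memberships by blast
    then have "p @ [b] \<in> worlds" by (simp add: acc_def)
    then have "(w, p @ [b]) \<in> bacc B"
      using w endpoint notin acc_siblings pa by (auto simp: bacc_def)
    then show ?thesis using b(2) by auto
  qed
qed

lemma truth_Box:
  assumes "w \<in> worlds" and "B \<in> S"
  shows "\<box> B \<in> last w \<longleftrightarrow> (\<forall>x. (w, x) \<in> acc \<longrightarrow> B \<in> last x)"
proof
  assume "\<box> B \<in> last w"
  then show "\<forall>x. (w, x) \<in> acc \<longrightarrow> B \<in> last x" using acc_step by (auto simp: step_def)
next
  assume all: "\<forall>x. (w, x) \<in> acc \<longrightarrow> B \<in> last x"
  show "\<box> B \<in> last w"
  proof (rule ccontr)
    assume "\<box> B \<notin> last w"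
    with assms(1) \<Phi>_memberships(3)[OF assms(2)] obtain a
      where "(w, w @ [a]) \<in> acc" "B \<notin> a" by (rule acc_witness)
    then show False using all by fastforce
  qed
qed

text \<open>At endpoints one direction is built into \<open>bacc\<close> and the other is
  \<open>endpoint_BBox_witness\<close>. Elsewhere \<open>Box Falsum\<close> fails, so
  \<open>BBox_Box\<close> and \<open>Box_cases\<close> identify \<open>BBox B\<close> with
  \<open>Box B\<close>, just as \<open>bacc B\<close> agrees with \<open>acc\<close>.\<close>

lemma truth_BBox:
  assumes w: "w \<in> worlds" and S: "\<^bold>\<box> B \<in> S"
  shows "\<^bold>\<box> B \<in> last w \<longleftrightarrow> (\<forall>x. (w, x) \<in> bacc B \<longrightarrow> B \<in> last x)"
proof (cases "acc `` {w} = {}")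
  case True
  then show ?thesis using endpoint_BBox_witness[OF w True S] by (auto simp: bacc_def)
next
  case False
  then obtain y where y: "(w, y) \<in> acc" by blast
  obtain M where M: "mcs M" "last w = M \<inter> \<Phi>" using last_traces[OF w] by (rule trace_mcs)
  have BS: "B \<in> S" using S S_components by blast
  have "\<^bold>\<bottom> \<notin> last y" using y Falsum_notin_last by (auto simp: acc_def)
  then have "\<box> \<^bold>\<bottom> \<notin> last w" using truth_Box w Falsum_S y by blast
  then have "\<box> \<^bold>\<bottom> \<notin> M" using M Falsum_S \<Phi>_memberships by blast
  then have "\<^bold>\<box> B \<in> M \<longleftrightarrow> \<box> B \<in> M"
    using mcs_axiom[OF M(1) GR_axiom.BBox_Box] mcs_axiom[OF M(1) GR_axiom.Box_cases]
      mcs_Or[OF M(1)] by blast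
  then have "\<^bold>\<box> B \<in> last w \<longleftrightarrow> \<box> B \<in> last w" using M \<Phi>_memberships(1)[OF S] \<Phi>_memberships(3)[OF BS] by auto
  moreover have "(w, x) \<in> bacc B \<longleftrightarrow> (w, x) \<in> acc" for x using False by (auto simp: bacc_def)
  ultimately show ?thesis using truth_Box[OF w BS] by simp
qed

lemma truth_lemma:
  assumes "B \<in> S" and "w \<in> worlds"
  shows "eval worlds acc bacc (\<lambda>w n. Var n \<in> last w) B w \<longleftrightarrow> B \<in> last w"
  using assms
proof (induction B arbitrary: w)
  case (Var n)
  then show ?case by simp
next
  case Falsum
  then show ?case using Falsum_notin_last by simp
next
  case (Neg B)
  obtain M where M: "mcs M" "last w = M \<inter> \<Phi>" using last_traces[OF Neg.prems(2)] by (rule trace_mcs)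
  have "B \<in> S" using Neg.prems S_components by blast
  then show ?case
    using Neg M mcs_Neg[OF M(1)] \<Phi>_memberships(1)[of B] \<Phi>_memberships(1)[of "\<^bold>\<not> B"] by simp
next
  case (Or B C)
  obtain M where M: "mcs M" "last w = M \<inter> \<Phi>" using last_traces[OF Or.prems(2)] by (rule trace_mcs)
  have "B \<in> S" "C \<in> S" using Or.prems S_components by blast+
  then show ?case
    using Or M mcs_Or[OF M(1)] \<Phi>_memberships(1)[of B] \<Phi>_memberships(1)[of C]
      \<Phi>_memberships(1)[of "B \<^bold>\<or> C"] by simp
next
  case (Box B)
  have "B \<in> S" using Box.prems S_components by blast
  then show ?case using Box truth_Box[of w B] by (auto simp: acc_def)
next
  case (BBox B)
  have "B \<in> S" using BBox.prems S_components by blast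
  moreover have "bacc B \<subseteq> worlds \<times> worlds" by (auto simp: bacc_def acc_def)
  ultimately show ?case using BBox truth_BBox[of w B] by auto
qed

end

lemma finite_countermodel:
  assumes "\<not> (\<turnstile>\<^sub>G\<^sub>R\<^sub>o A)"
  obtains W :: "fm set list set" and R P where "finite W" "GRo_frame W R P" "\<not> valid_on W R P A"
proof -
  interpret countermodel "insert \<^bold>\<bottom> (subfms A)"
    using finite_subfms subfms_trans by unfold_locales auto
  obtain M where M: "mcs M" "A \<notin> M" using assms by (rule unprovable_mcs)
  then have w: "[M \<inter> \<Phi>] \<in> worlds" by (auto simp: worlds_singleton traces_def)
  then have "\<not> eval worlds acc bacc (\<lambda>w n. Var n \<in> last w) A [M \<inter> \<Phi>]"
    using truth_lemma[of A] subfms_self M by simp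
  then have "\<not> valid_on worlds acc bacc A"
    unfolding valid_on_def using GRo_model_eval w by blast
  then show thesis using that finite_worlds GRo_frame_worlds w by blast
qed

section \<open>Frames on a given infinite type\<close>

lemma GRo_frame_inv_image:
  assumes frame: "GRo_frame W R P" and bij: "bij_betw g W' W"
  shows "GRo_frame W' (inv_image R g \<inter> W' \<times> W') (\<lambda>B. inv_image (P B) g \<inter> W' \<times> W')"
proof -
  have W: "W = g ` W'" using bij by (simp add: bij_betw_def)
  have "trans R" "wf (R\<inverse>)" using frame by (auto simp: GRo_frame_def)
  then have "trans (inv_image R g \<inter> W' \<times> W')" by (auto simp: trans_def)
  moreover have "wf ((inv_image R g \<inter> W' \<times> W')\<inverse>)"
    by (rule wf_subset[OF wf_inv_image[OF \<open>wf (R\<inverse>)\<close>, of g]]) auto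
  moreover have "W' \<noteq> {}" using frame W by (auto simp: GRo_frame_def)
  moreover have "(x, y) \<in> P B" if "(x, y) \<in> R" for x y B
    using frame that unfolding GRo_frame_def by blast
  moreover have "(x, z) \<in> R" if "(x, y) \<in> R" "(y, z) \<in> P B" for x y z B
    using frame that unfolding GRo_frame_def by blast
  moreover have "(x, y) \<in> R" if "(x, y) \<in> P B" "(x, z) \<in> R" for x y z B
    using frame that unfolding GRo_frame_def by blast
  \<comment> \<open>The existential frame condition needs its witness pulled back to
    \<open>W'\<close>, hence the surjectivity of \<open>g\<close>.\<close>
  moreover have "\<exists>z\<in>W'. (y, g z) \<in> P B \<and> (x, g z) \<in> R" if "(x, y) \<in> R" for x y B
  proof -
    have "\<exists>z\<in>W. (y, z) \<in> P B \<and> (x, z) \<in> R"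
      using frame that unfolding GRo_frame_def by blast
    then show ?thesis by (simp add: W)
  qed
  ultimately show ?thesis
    unfolding GRo_frame_def in_inv_image Int_iff mem_Sigma_iff
    by (intro conjI allI ballI impI) blast+
qed

lemma GRo_model_inv_image:
  assumes "GRo_model W R P sat" and bij: "bij_betw g W' W"
  shows "GRo_model W' (inv_image R g \<inter> W' \<times> W') (\<lambda>B. inv_image (P B) g \<inter> W' \<times> W')
    (\<lambda>w. sat (g w))"
proof -
  have W: "W = g ` W'" using bij by (simp add: bij_betw_def)
  show ?thesis using assms(1) unfolding GRo_model_def W by simp
qed

lemma valid_on_inv_image:
  assumes "valid_on W' (inv_image R g \<inter> W' \<times> W') (\<lambda>B. inv_image (P B) g \<inter> W' \<times> W') A"
    and bij: "bij_betw g W' W"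
  shows "valid_on W R P A"
  using assms GRo_model_inv_image[OF _ bij] unfolding valid_on_def
  by (fastforce simp: bij_betw_def)

text \<open>The countermodel lives on lists of formula sets. Being finite, it has a copy in any
  infinite type, which contains sets of every finite cardinality.\<close>

lemma GRo_finite_complete:
  assumes inf: "infinite (UNIV :: 'w set)"
    and valid: "valid_on_all_finite_frames TYPE('w) A"
  shows "\<turnstile>\<^sub>G\<^sub>R\<^sub>o A"
proof (rule ccontr)
  assume "\<not> (\<turnstile>\<^sub>G\<^sub>R\<^sub>o A)"
  then obtain W :: "fm set list set" and R P
    where W: "finite W" "GRo_frame W R P" "\<not> valid_on W R P A"
    by (rule finite_countermodel)
  obtain W' :: "'w set" where "finite W'" "card W' = card W"
    using infinite_arbitrarily_large[OF inf] by blast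
  then obtain g where g: "bij_betw g W' W" using finite_same_card_bij W(1) by blast
  have "valid_on W' (inv_image R g \<inter> W' \<times> W') (\<lambda>B. inv_image (P B) g \<inter> W' \<times> W') A"
    using valid GRo_frame_inv_image[OF W(2) g] \<open>finite W'\<close>
    unfolding valid_on_all_finite_frames_def by blast
  then show False using valid_on_inv_image g W(3) by blast
qed

theorem theorem4p5:
  fixes A :: fm
  assumes "infinite (UNIV :: 'w set)"
  shows "((\<turnstile>\<^sub>G\<^sub>R\<^sub>o A) \<longleftrightarrow> valid_on_all_frames TYPE('w) A) \<and>
         (valid_on_all_frames TYPE('w) A \<longleftrightarrow> valid_on_all_finite_frames TYPE('w) A)"
proof -
  have "(\<turnstile>\<^sub>G\<^sub>R\<^sub>o A) \<Longrightarrow> valid_on_all_frames TYPE('w) A"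
    by (simp add: valid_on_all_frames_def GRo_sound)
  moreover have "valid_on_all_frames TYPE('w) A \<Longrightarrow> valid_on_all_finite_frames TYPE('w) A"
    by (simp add: valid_on_all_frames_def valid_on_all_finite_frames_def)
  ultimately show ?thesis using GRo_finite_complete[OF assms] by blast
qed

end
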